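(* The generalised first-order Galilean group satisfies $$T\mathfrak{Gal}=\big\{A\in\mathcal L_{pa}(T\mathcal E,T\mathcal E)\ :\ A\text{ invertible},\ a\text{ invertible},\ A^*\mathfrak g=\mathfrak g,\ A^*\gamma=\gamma\ \text{ and }\ (Ta)^*\gamma=\gamma\big\},$$ where $a:\mathcal E\to\mathcal E$ denotes the punctual shadow of $A$.
   Context: Smooth means at least $C^1$ (maps are understood regular enough that tangent maps occurring are smooth). Ambient space. $\mathbb E=\mathbb R^3$ with Euclidean metric $\mathbf g$; $\mathcal E=\mathbb R^3\times\mathbb R^3\ni(\bar x,y)$ with $\pi_{\mathcal E}(\bar x,y)=\bar x$; elements of $T\mathcal E$ are written $((\bar x,y),(\delta\bar x,\delta y))$. $V\mathcal E=\ker T\pi_{\mathcal E}$. The connection is $\gamma_{(\bar x,y)}(\delta\bar x)=((\bar x,y),(\delta\bar x,0))$, the projection of interpretation is $\iota:T\mathcal E\to T\mathbb E$, $((\bar x,y),(\delta\bar x,\delta y))\mapsto(\bar x,\delta\bar x+\delta y)$, and the pseudo-metric is $\mathfrak g=\iota^*\mathbf g$, i.e. $\langle(\delta\bar x,\delta y),(\delta\bar x',\delta y')\rangle_{\mathfrak g}=(\delta\bar x+\delta y)\cdot(\delta\bar x'+\delta y')$. $\mathrm{Aff}(\mathcal E,\mathcal E)$ is the set of smooth maps $a:\mathcal E\to\mathcal E$ covering a smooth $\bar a:\mathbb E\to\mathbb E$ ($\pi_{\mathcal E}\circ a=\bar a\circ\pi_{\mathcal E}$) and affine on each fibre. $\mathcal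 L_{pa}(T\mathcal E,T\mathcal E)$ is the set of smooth maps $A:T\mathcal E\to T\mathcal E$ such that: (1) $A$ is a vector bundle morphism over some $a\in\mathrm{Aff}(\mathcal E,\mathcal E)$ (its punctual shadow); (2) $T\pi_{\mathcal E}\circ A=\bar A\circ T\pi_{\mathcal E}$ with $\bar A:=T\bar a$; (3) $A|_{V\mathcal E}=(Ta)|_{V\mathcal E}$; (4) for fixed $(\delta\bar x,\delta y)$, the components of $A_{(\bar x,y)}(\delta\bar x,\delta y)$ are affine in $y$. Pull-backs: $\langle u,w\rangle_{A^*\mathfrak g}=\langle Au,Aw\rangle_{\mathfrak g}$; $(A^*\gamma)_x=A_x^{-1}\circ\gamma_{a(x)}\circ\bar A$ for $x\in\mathcal E$; likewise $((Ta)^*\gamma)_x=(T_xa)^{-1}\circ\gamma_{a(x)}\circ T\bar a$. $\mathrm{Gal}$ is the group of maps $\bar x\mapsto R\bar x+\bar t$ of $\mathbb R^3$ with $R\in O(3)$, $\bar t\in\mathbb R^3$; $T\mathrm{Gal}=\{TO:O\in\mathrm{Gal}\}$. The generalised first-order Galilean group is $T\mathfrak{Gal}=\{Ta:a\in\mathrm{Aff}(\mathcal E,\mathcal E),\ \exists\,O\in T\mathrm{Gal},\ \iota\circ Ta=O\circ\iota\}$. *)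

theory Defs
  imports "HOL-Analysis.Analysis"
begin

type_synonym base = "real^3"
type_synonym tbase = "base \<times> base"
type_synonym total = "base \<times> base"
type_synonym ttotal = "total \<times> (base \<times> base)"

text \<open>
  The tangent bundle of a vector space \<open>V\<close> is \<open>V \<times> V\<close> (base point, tangent vector), so
  \<^const>\<open>fst\<close> is both the projection of \<^typ>\<open>total\<close> onto \<^typ>\<open>base\<close> and that of a tangent
  bundle onto its base.
\<close>

definition C1 :: "('a::euclidean_space \<Rightarrow> 'b::euclidean_space) \<Rightarrow> bool" where
  "C1 f \<longleftrightarrow> (\<exists>f' :: 'a \<Rightarrow> 'a \<Rightarrow>\<^sub>L 'b.
     (\<forall>x. (f has_derivative blinfun_apply (f' x)) (at x)) \<and> continuous_on UNIV f')"

definition tangent_map ::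
    "('a::euclidean_space \<Rightarrow> 'b::euclidean_space) \<Rightarrow> 'a \<times> 'a \<Rightarrow> 'b \<times> 'b" where
  "tangent_map f = (\<lambda>(x, v). (f x, frechet_derivative f (at x) v))"

definition tangent_space :: "'a \<Rightarrow> ('a \<times> 'a) set" where
  "tangent_space x = {x} \<times> UNIV"

definition affine_fun :: "('a::real_vector \<Rightarrow> 'b::real_vector) \<Rightarrow> bool" where
  "affine_fun h \<longleftrightarrow> (\<exists>L c. linear L \<and> (\<forall>y. h y = L y + c))"

text \<open>
  The map of base spaces that \<open>f\<close> covers. It is used for the map \<open>total \<Rightarrow> total\<close> under a vector
  bundle morphism of \<open>ttotal\<close> (the punctual shadow), and for the map \<open>base \<Rightarrow> base\<close> under a map of
  \<open>total\<close>.
\<close>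

definition covered :: "('a \<times> 'b \<Rightarrow> 'c \<times> 'd) \<Rightarrow> 'a \<Rightarrow> 'c" where
  "covered f = (THE g. fst \<circ> f = g \<circ> fst)"

lemma covered_eq:
  assumes "fst \<circ> f = g \<circ> fst"
  shows "covered f = g"
  unfolding covered_def
proof (rule the_equality)
  show "fst \<circ> f = g \<circ> fst" by (fact assms)
  show "h = g" if "fst \<circ> f = h \<circ> fst" for h
    using assms that by (metis comp_apply fst_conv ext)
qed

lemma covered_tangent_map: "covered (tangent_map f) = f"
  by (rule covered_eq) (auto simp: tangent_map_def)

definition Aff :: "(total \<Rightarrow> total) set" where
  "Aff = {a. C1 a \<and> (\<exists>abar. C1 abar \<and> fst \<circ> a = abar \<circ> fst) \<and>
             (\<forall>x. affine_fun (\<lambda>y. snd (a (x, y))))}"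

definition vertical_bundle :: "ttotal set" where
  "vertical_bundle = {w. snd (tangent_map (fst :: total \<Rightarrow> base) w) = 0}"

definition bundle_morphism_over ::
    "('a \<times> 'b::real_vector \<Rightarrow> 'c \<times> 'd::real_vector) \<Rightarrow> ('a \<Rightarrow> 'c) \<Rightarrow> bool" where
  "bundle_morphism_over A a \<longleftrightarrow> fst \<circ> A = a \<circ> fst \<and> (\<forall>p. linear (\<lambda>v. snd (A (p, v))))"

definition Lpa :: "(ttotal \<Rightarrow> ttotal) set" where
  "Lpa = {A. C1 A \<and>
     (\<exists>a\<in>Aff. bundle_morphism_over A a \<and>
        tangent_map fst \<circ> A = tangent_map (covered a) \<circ> tangent_map fst \<and>
        (\<forall>w\<in>vertical_bundle. A w = tangent_map a w)) \<and>
     (\<forall>x v. affine_fun (\<lambda>y. snd (A ((x, y), v))))}"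

text \<open>
  The projection of interpretation, the connection (the second argument of which is meant to be a
  tangent vector at \<open>fst p\<close>), and the metrics. A metric takes two tangent vectors at the same point.
\<close>

definition interp :: "ttotal \<Rightarrow> tbase" where
  "interp = (\<lambda>((x, y), (dx, dy)). (x, dx + dy))"

definition connection :: "total \<Rightarrow> tbase \<Rightarrow> ttotal" where
  "connection p u = (p, (snd u, 0))"

definition pullback_metric :: "('p \<Rightarrow> 'q) \<Rightarrow> ('q \<Rightarrow> 'q \<Rightarrow> real) \<Rightarrow> 'p \<Rightarrow> 'p \<Rightarrow> real" where
  "pullback_metric f h u w = h (f u) (f w)"

definition euclidean_metric :: "tbase \<Rightarrow> tbase \<Rightarrow> real" where
  "euclidean_metric u w = snd u \<bullet> snd w"

definition pseudo_metric :: "ttotal \<Rightarrow> ttotal \<Rightarrow> real" where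
  "pseudo_metric = pullback_metric interp euclidean_metric"

definition preserves_pseudo_metric :: "(ttotal \<Rightarrow> ttotal) \<Rightarrow> bool" where
  "preserves_pseudo_metric A \<longleftrightarrow>
     (\<forall>p. \<forall>u\<in>tangent_space p. \<forall>w\<in>tangent_space p.
        pullback_metric A pseudo_metric u w = pseudo_metric u w)"

text \<open>
  The inverse below is that of the restriction of \<open>A\<close> to the tangent space at \<open>p\<close>. By
  \<open>covered_tangent_map\<close>, the case \<open>A = tangent_map a\<close> is the pull-back of a connection by the
  tangent map of \<open>a\<close>.
\<close>

definition pullback_connection ::
    "(ttotal \<Rightarrow> ttotal) \<Rightarrow> (total \<Rightarrow> tbase \<Rightarrow> ttotal) \<Rightarrow> total \<Rightarrow> tbase \<Rightarrow> ttotal" where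
  "pullback_connection A \<Gamma> p =
     inv_into (tangent_space p) A \<circ> \<Gamma> (covered A p) \<circ> tangent_map (covered (covered A))"

definition preserves_connection :: "(ttotal \<Rightarrow> ttotal) \<Rightarrow> bool" where
  "preserves_connection A \<longleftrightarrow>
     (\<forall>p. \<forall>u\<in>tangent_space (fst p). pullback_connection A connection p u = connection p u)"

definition Gal :: "(base \<Rightarrow> base) set" where
  "Gal = {\<lambda>x. R *v x + t | R t. orthogonal_matrix R}"

definition TGal :: "(tbase \<Rightarrow> tbase) set" where
  "TGal = tangent_map ` Gal"

definition generalised_TGal :: "(ttotal \<Rightarrow> ttotal) set" where
  "generalised_TGal =
     {tangent_map a | a. a \<in> Aff \<and> (\<exists>G\<in>TGal. interp \<circ> tangent_map a = G \<circ> interp)}"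

end

theory Submission
  imports Defs
begin

text \<open>
  Both sides consist of the tangent maps of \<open>(x, y) \<mapsto> (R x + t, R y + c)\<close> with \<open>R\<close> orthogonal.
  On the Galilean side, evaluating \<open>\<iota> \<circ> Ta = O \<circ> \<iota>\<close> gives the derivative of \<open>a\<close> as \<open>R \<oplus> R\<close>.
  On the other side, the two conditions on the connection say that \<open>A\<close> and \<open>Ta\<close> agree on horizontal
  vectors, so that \<open>A = Ta\<close>. The pseudo-metric is degenerate exactly on the vectors \<open>(v, -v)\<close>, and
  its preservation makes the derivative of \<open>a\<close> at \<open>p\<close> a sum \<open>S\<^sub>p \<oplus> S\<^sub>p\<close> with \<open>S\<^sub>p\<close> orthogonal.
  The first component of \<open>a\<close> depends only on \<open>x\<close> and the second only on \<open>y\<close>, so \<open>S\<^sub>p\<close> is constant.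
\<close>

section \<open>Tangent maps, and maps whose derivative is constant\<close>

lemma tangent_map_eq:
  assumes "(f has_derivative f') (at x)"
  shows "tangent_map f (x, v) = (f x, f' v)"
  using frechet_derivative_at[OF assms] by (simp add: tangent_map_def)

lemma tangent_map_fst:
  "tangent_map (fst :: 'a::euclidean_space \<times> 'b::euclidean_space \<Rightarrow> 'a) w = (fst (fst w), fst (snd w))"
proof -
  have "(fst has_derivative fst) (at (fst w))"
    by (rule has_derivative_fst) (rule has_derivative_ident)
  from tangent_map_eq[OF this, of "snd w"] show ?thesis by simp
qed

lemma C1_imp_has_derivative:
  assumes "C1 f"
  shows "(f has_derivative frechet_derivative f (at x)) (at x)"
  using assms frechet_derivative_works unfolding C1_def differentiable_def by blast

lemma C1_affine:
  assumes "linear L"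
  shows "C1 (\<lambda>x. L x + c)"
  unfolding C1_def
proof (intro exI conjI allI)
  have L: "bounded_linear L"
    using assms by (simp add: linear_conv_bounded_linear)
  show "((\<lambda>x. L x + c) has_derivative blinfun_apply ((\<lambda>_. Blinfun L) x)) (at x)" for x
    using L by (auto simp: bounded_linear_Blinfun_apply
        intro!: derivative_eq_intros bounded_linear_imp_has_derivative)
qed simp

text \<open>The difference of \<open>f\<close> and \<open>L\<close> has derivative zero everywhere
  on a convex domain, hence is constant; its value at \<open>0\<close> is
  \<open>f 0\<close>.\<close>

lemma constant_derivative_imp_affine:
  assumes "\<And>x. (f has_derivative L) (at x)"
  shows "f x = L x + f 0"
proof -
  have L: "bounded_linear L"
    using assms by (rule has_derivative_bounded_linear)
  have "((\<lambda>x. f x - L x) has_derivative (\<lambda>_. 0)) (at x within UNIV)" for x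
    by (rule derivative_eq_intros assms bounded_linear_imp_has_derivative[OF L] refl)+ simp
  then obtain c where c: "\<And>x. f x - L x = c"
    using has_derivative_zero_constant[of UNIV "\<lambda>x. f x - L x"] by auto
  have "L 0 = 0"
    by (rule linear_0) (rule bounded_linear.linear[OF L])
  with c[of x] c[of 0] show ?thesis
    by (simp add: algebra_simps)
qed

lemma tangent_map_Gal:
  "tangent_map (\<lambda>x::base. R *v x + t) (x, v) = (R *v x + t, R *v v)"
  by (rule tangent_map_eq)
    (auto intro!: derivative_eq_intros bounded_linear_imp_has_derivative
      simp: matrix_vector_mul_bounded_linear)

lemma pseudo_metric_apply:
  "pseudo_metric (p, v) (q, w) = (fst v + snd v) \<bullet> (fst w + snd w)"
  by (simp add: pseudo_metric_def pullback_metric_def euclidean_metric_def interp_def case_prod_beta)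

section \<open>Rigid motions of the total space and their membership in both sets\<close>

text \<open>Written as a linear map plus a constant, the shape that \<open>C1_affine\<close> and
  \<open>has_derivative_add_const\<close> match.\<close>

definition rigid_motion :: "real^3^3 \<Rightarrow> base \<Rightarrow> base \<Rightarrow> total \<Rightarrow> total" where
  "rigid_motion R t c = (\<lambda>p. (R *v fst p, R *v snd p) + (t, c))"

lemma rigid_motion_apply: "rigid_motion R t c p = (R *v fst p + t, R *v snd p + c)"
  by (simp add: rigid_motion_def)

text \<open>General in \<open>L\<close> because it is used on two levels: for multiplication by
  \<open>R\<close>, and for the resulting map of \<open>total\<close> when the tangent map is
  formed.\<close>

lemma linear_on_components:
  assumes "linear L"
  shows "linear (\<lambda>p. (L (fst p), L (snd p)))"
  by (rule linearI) (simp_all add: linear_add[OF assms] linear_cmul[OF assms])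

lemma linear_rigid_motion: "linear (\<lambda>p :: total. (R *v fst p, R *v snd p))"
  by (rule linear_on_components) simp

lemma tangent_map_rigid_motion:
  "tangent_map (rigid_motion R t c) (p, v) = (rigid_motion R t c p, (R *v fst v, R *v snd v))"
proof (rule tangent_map_eq)
  have "bounded_linear (\<lambda>p :: total. (R *v fst p, R *v snd p))"
    using linear_rigid_motion by (simp add: linear_conv_bounded_linear)
  from bounded_linear_imp_has_derivative[OF this]
  show "(rigid_motion R t c has_derivative (\<lambda>v. (R *v fst v, R *v snd v))) (at p)"
    unfolding rigid_motion_def by (rule has_derivative_add_const)
qed

lemma rigid_motion_covers: "fst \<circ> rigid_motion R t c = (\<lambda>x. R *v x + t) \<circ> fst"
  by (auto simp: rigid_motion_def)

lemma rigid_motion_in_Aff: "rigid_motion R t c \<in> Aff"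
proof -
  have "C1 (\<lambda>x::base. R *v x + t)"
    by (rule C1_affine) simp
  moreover have "affine_fun (\<lambda>y. snd (rigid_motion R t c (x, y)))" for x
    unfolding affine_fun_def rigid_motion_def
    by (intro exI[of _ "(*v) R"] exI[of _ c]) simp
  moreover have "C1 (rigid_motion R t c)"
    unfolding rigid_motion_def by (rule C1_affine[OF linear_rigid_motion])
  ultimately show ?thesis
    using rigid_motion_covers unfolding Aff_def by blast
qed

text \<open>The tangent map of an affine map is again affine, hence \<open>C1\<close>. Its vector
  part does not depend on the base point, so it is affine in \<open>y\<close> with linear part
  zero.\<close>

lemma tangent_map_rigid_motion_in_Lpa: "tangent_map (rigid_motion R t c) \<in> Lpa"
proof -
  let ?a = "rigid_motion R t c" and ?M = "\<lambda>p :: total. (R *v fst p, R *v snd p)"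
  have "tangent_map ?a = (\<lambda>w. (?M (fst w), ?M (snd w)) + ((t, c), 0))"
  proof
    show "tangent_map ?a w = (?M (fst w), ?M (snd w)) + ((t, c), 0)" for w
      using tangent_map_rigid_motion[of R t c "fst w" "snd w"] by (simp add: rigid_motion_def)
  qed
  moreover have "linear (\<lambda>w. (?M (fst w), ?M (snd w)))"
    by (rule linear_on_components[OF linear_rigid_motion])
  ultimately have "C1 (tangent_map ?a)"
    using C1_affine[of "\<lambda>w. (?M (fst w), ?M (snd w))" "((t, c), 0)"] by (simp only:)
  moreover have "bundle_morphism_over (tangent_map ?a) ?a"
    unfolding bundle_morphism_over_def
    by (auto simp: tangent_map_rigid_motion linear_rigid_motion)
  moreover have "tangent_map fst \<circ> tangent_map ?a = tangent_map (covered ?a) \<circ> tangent_map fst"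
    by (intro ext) (simp add: split_paired_all covered_eq[OF rigid_motion_covers]
        tangent_map_fst tangent_map_rigid_motion tangent_map_Gal rigid_motion_apply)
  moreover have "affine_fun (\<lambda>y. snd (tangent_map ?a ((x, y), v)))" for x v
    unfolding affine_fun_def tangent_map_rigid_motion
    by (intro exI[of _ "\<lambda>_. 0"] exI[of _ "?M v"]) (simp add: module_hom_zero)
  ultimately show ?thesis
    unfolding Lpa_def using rigid_motion_in_Aff by auto
qed

lemma orthogonal_matrix_vector_cancel:
  fixes R :: "real^'n^'n"
  assumes "orthogonal_matrix R"
  shows "R *v (transpose R *v v) = v" and "transpose R *v (R *v v) = v"
  using assms by (simp_all add: orthogonal_matrix_def matrix_vector_mul_assoc
      del: transpose_matrix_vector)

lemma orthogonal_matrix_inner: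
  fixes R :: "real^'n^'n"
  assumes "orthogonal_matrix R"
  shows "(R *v v) \<bullet> (R *v w) = v \<bullet> w"
  by (metis assms dot_lmul_matrix orthogonal_matrix_vector_cancel(2) transpose_matrix_vector)

text \<open>Transposes provide the inverses. For the metric, \<open>R\<close> factors out of the sum
  of the two tangent components and is then absorbed by orthogonality.\<close>

lemma rigid_motion_preserves:
  fixes t c :: base
  assumes R: "orthogonal_matrix R"
  defines "a \<equiv> rigid_motion R t c"
  shows "bij a" and "bij (tangent_map a)" and "preserves_pseudo_metric (tangent_map a)"
    and "preserves_connection (tangent_map a)"
proof -
  note Ta = tangent_map_rigid_motion[of R t c, folded a_def]
  note cancel = orthogonal_matrix_vector_cancel[OF R]
  show "bij a"
    by (rule bij_betw_byWitness[where
          f' = "\<lambda>p. (transpose R *v (fst p - t), transpose R *v (snd p - c))"])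
      (auto simp: a_def rigid_motion_def cancel simp del: transpose_matrix_vector)
  then have inv_a: "inv a (a p) = p" "a (inv a p) = p" for p
    by (simp_all add: bij_is_inj bij_is_surj surj_f_inv_f)
  show bij_Ta: "bij (tangent_map a)"
    by (rule bij_betw_byWitness[where
          f' = "\<lambda>w. (inv a (fst w), (transpose R *v fst (snd w), transpose R *v snd (snd w)))"])
      (auto simp: Ta cancel inv_a simp del: transpose_matrix_vector)
  show "preserves_pseudo_metric (tangent_map a)"
    unfolding preserves_pseudo_metric_def pullback_metric_def
    by (auto simp: tangent_space_def Ta pseudo_metric_apply orthogonal_matrix_inner[OF R]
        simp flip: matrix_vector_right_distrib)
  show "preserves_connection (tangent_map a)"
    unfolding preserves_connection_def
  proof (intro allI ballI)
    fix p :: total and u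
    assume "u \<in> tangent_space (fst p)"
    then obtain v where u: "u = (fst p, v)"
      by (auto simp: tangent_space_def)
    have "covered a = (\<lambda>x. R *v x + t)"
      unfolding a_def by (rule covered_eq[OF rigid_motion_covers])
    \<comment> \<open>Both sides are \<open>(a p, (R *v v, 0))\<close>: the derivative of
      \<open>a\<close> is block diagonal, so horizontal vectors stay horizontal. Injectivity then
      lets \<open>inv_into\<close> undo \<open>tangent_map a\<close>.\<close>
    then have "connection (a p) (tangent_map (covered a) u) = tangent_map a (connection p u)"
      by (simp add: u connection_def tangent_map_Gal Ta)
    moreover have "inj_on (tangent_map a) (tangent_space p)"
      using bij_Ta by (meson bij_is_inj inj_on_subset subset_UNIV)
    moreover have "connection p u \<in> tangent_space p"
      by (simp add: connection_def tangent_space_def)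
    ultimately show "pullback_connection (tangent_map a) connection p u = connection p u"
      by (simp add: pullback_connection_def covered_tangent_map inv_into_f_f)
  qed
qed

lemma rigid_motion_in_generalised_TGal:
  assumes "orthogonal_matrix R"
  shows "tangent_map (rigid_motion R t c) \<in> generalised_TGal"
proof -
  have "interp \<circ> tangent_map (rigid_motion R t c) = tangent_map (\<lambda>x. R *v x + t) \<circ> interp"
    by (intro ext) (simp add: split_paired_all interp_def tangent_map_rigid_motion tangent_map_Gal rigid_motion_apply
        matrix_vector_right_distrib)
  moreover have "tangent_map (\<lambda>x. R *v x + t) \<in> TGal"
    using assms unfolding TGal_def Gal_def by blast
  ultimately show ?thesis
    unfolding generalised_TGal_def using rigid_motion_in_Aff by blast
qed

section \<open>Recognising rigid motions by their derivative\<close>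

lemma derivative_imp_rigid_motion:
  fixes a :: "total \<Rightarrow> total"
  assumes "\<And>p. (a has_derivative (\<lambda>v. (R *v fst v, R *v snd v))) (at p)"
  shows "a = rigid_motion R (fst (a 0)) (snd (a 0))"
proof
  show "a p = rigid_motion R (fst (a 0)) (snd (a 0)) p" for p
    using constant_derivative_imp_affine[OF assms, of p] by (simp add: rigid_motion_def)
qed

text \<open>The last claim differentiates the covering identity
  \<open>fst \<circ> a = covered a \<circ> fst\<close> and uses uniqueness of derivatives. It makes
  the derivative of \<open>a\<close> block triangular for the splitting into horizontal and vertical
  vectors.\<close>

lemma Aff_derivative:
  assumes a: "a \<in> Aff"
  defines "D \<equiv> \<lambda>p. frechet_derivative a (at p)"
    and "D' \<equiv> \<lambda>x. frechet_derivative (covered a) (at x)"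
  shows "(a has_derivative D p) (at p)" and "(covered a has_derivative D' x) (at x)"
    and "fst \<circ> a = covered a \<circ> fst" and "fst (D p v) = D' (fst p) (fst v)"
proof -
  have "C1 a" and cov: "fst \<circ> a = covered a \<circ> fst" and "C1 (covered a)"
    using a covered_eq by (auto simp: Aff_def)
  then have D: "(a has_derivative D p) (at p)" and D': "(covered a has_derivative D' x) (at x)"
    for p x
    unfolding D_def D'_def by (simp_all add: C1_imp_has_derivative)
  have "((\<lambda>p. fst (a p)) has_derivative (\<lambda>v. fst (D p v))) (at p)"
    by (rule has_derivative_fst[OF D])
  moreover have "((\<lambda>p. covered a (fst p)) has_derivative (\<lambda>v. D' (fst p) (fst v))) (at p)"
    by (rule has_derivative_compose[OF has_derivative_fst[OF has_derivative_ident] D'])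
  moreover have "(\<lambda>p. fst (a p)) = (\<lambda>p. covered a (fst p))"
    using cov by (simp add: comp_def)
  ultimately show "fst (D p v) = D' (fst p) (fst v)"
    by (metis has_derivative_unique)
  show "(a has_derivative D p) (at p)" "(covered a has_derivative D' x) (at x)"
    "fst \<circ> a = covered a \<circ> fst"
    by (fact D D' cov)+
qed

text \<open>The base point component of the intertwining relation determines the covered map, hence
  the first component of the derivative of \<open>a\<close>; the vector component then determines
  the second.\<close>

lemma generalised_TGal_cases:
  assumes "A \<in> generalised_TGal"
  obtains R t c where "orthogonal_matrix R" "A = tangent_map (rigid_motion R t c)"
proof -
  obtain a R t where A: "A = tangent_map a" and a: "a \<in> Aff" and R: "orthogonal_matrix R"
    and eq: "interp \<circ> tangent_map a = tangent_map (\<lambda>x. R *v x + t) \<circ> interp"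
    using assms unfolding generalised_TGal_def TGal_def Gal_def by auto
  define abar where "abar = covered a"
  define D where "D p = frechet_derivative a (at p)" for p
  define D' where "D' x = frechet_derivative abar (at x)" for x
  note D = Aff_derivative(1)[OF a, folded D_def]
    and D' = Aff_derivative(2)[OF a, folded abar_def, folded D'_def]
    and cov = Aff_derivative(3)[OF a, folded abar_def]
    and fst_D = Aff_derivative(4)[OF a, folded abar_def, folded D_def D'_def]
  have Ta: "tangent_map a (p, v) = (a p, D p v)"
    and Tabar: "tangent_map abar (x, w) = (abar x, D' x w)" for p v x w
    by (simp_all add: tangent_map_def D_def D'_def)
  have eq_at: "fst (a p) = R *v fst p + t" "fst (D p v) + snd (D p v) = R *v (fst v + snd v)"
    for p v
    using fun_cong[OF eq, of "(p, v)"]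
    by (simp_all only: comp_apply Ta interp_def tangent_map_Gal case_prod_beta fst_conv snd_conv
        prod.inject)
  have "abar = (\<lambda>x. R *v x + t)"
  proof
    show "abar x = R *v x + t" for x
      using fun_cong[OF cov, of "(x, 0)"] eq_at(1)[of "(x, 0)"] by simp
  qed
  then have "D' x v = R *v v" for x v
    using Tabar[of x v] tangent_map_Gal[of R t x v] by simp
  \<comment> \<open>The first component is \<open>R *v fst v\<close> by \<open>fst_D\<close>;
    subtracting it from the sum in \<open>eq_at(2)\<close> leaves \<open>R *v snd v\<close>.\<close>
  then have "D p = (\<lambda>v. (R *v fst v, R *v snd v))" for p
    using fst_D[of p] eq_at(2)[of p]
    by (auto simp: prod_eq_iff matrix_vector_right_distrib fun_eq_iff)
  with D have "a = rigid_motion R (fst (a 0)) (snd (a 0))"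
    by (intro derivative_imp_rigid_motion) simp
  with A R that show ?thesis by metis
qed

section \<open>Consequences of preserving the connections and the pseudo-metric\<close>

text \<open>Applying \<open>A\<close> to both sides of the pull-back identity removes the inverse.
  Surjectivity on the tangent space enters because \<open>inv_into\<close> yields a genuine preimage
  only for elements of the image.\<close>

lemma preserves_connection_horizontal:
  assumes A: "fst \<circ> A = a \<circ> fst" and a: "fst \<circ> a = abar \<circ> fst"
    and surj: "tangent_space (a p) \<subseteq> A ` tangent_space p"
    and pres: "preserves_connection A"
  shows "A (p, (v, 0)) = (a p, (snd (tangent_map abar (fst p, v)), 0))"
proof -
  let ?h = "connection (a p) (tangent_map abar (fst p, v))"
  have "inv_into (tangent_space p) A ?h = connection p (fst p, v)"
    using pres[unfolded preserves_connection_def pullback_connection_def covered_eq[OF A]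
        covered_eq[OF a], rule_format, of "(fst p, v)" p] by (simp add: tangent_space_def)
  moreover have "?h \<in> A ` tangent_space p"
    using surj by (auto simp: connection_def tangent_space_def)
  ultimately have "A (connection p (fst p, v)) = ?h"
    using f_inv_into_f by metis
  then show ?thesis
    by (simp add: connection_def)
qed

text \<open>Vanishing off-diagonal blocks make the second component of \<open>a\<close> a function
  of \<open>y\<close> alone and the first a function of \<open>x\<close> alone. Differentiating the
  second shows that \<open>S\<close> is independent of \<open>x\<close>, differentiating the first
  that \<open>S (0, y)\<close> is independent of \<open>y\<close>; no second derivatives
  occur.\<close>

lemma block_diagonal_derivative_constant:
  fixes a :: "'a::euclidean_space \<times> 'a \<Rightarrow> 'a \<times> 'a"
  assumes D: "\<And>p. (a has_derivative (\<lambda>v. (S p (fst v), S p (snd v)))) (at p)"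
  shows "S p = S 0"
proof -
  have along_x: "((\<lambda>x. a (x, y)) has_derivative (\<lambda>v. (S (x, y) v, S (x, y) 0))) (at x)" for x y
    using has_derivative_compose[OF has_derivative_Pair[OF has_derivative_ident
          has_derivative_const] D] by simp
  have along_y: "((\<lambda>y. a (x, y)) has_derivative (\<lambda>v. (S (x, y) 0, S (x, y) v))) (at y)" for x y
    using has_derivative_compose[OF has_derivative_Pair[OF has_derivative_const
          has_derivative_ident] D] by simp
  have S0: "S p 0 = 0" for p
    using linear_0[OF has_derivative_linear[OF D[of p]]] by (simp add: zero_prod_def)
  have "((\<lambda>x. snd (a (x, y))) has_derivative (\<lambda>_. 0)) (at x)" for x y
    using has_derivative_snd[OF along_x[where x=x and y=y]] by (simp add: S0)
  \<comment> \<open>With the zero map as derivative, the affine form reduces to a constant.\<close>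
  then have snd_a: "snd (a (x, y)) = snd (a (0, y))" for x y
    by (rule constant_derivative_imp_affine[of "\<lambda>x. snd (a (x, y))" "\<lambda>_. 0", simplified])
  have "((\<lambda>y. fst (a (x, y))) has_derivative (\<lambda>_. 0)) (at y)" for x y
    using has_derivative_fst[OF along_y[where x=x and y=y]] by (simp add: S0)
  then have fst_a: "fst (a (x, y)) = fst (a (x, 0))" for x y
    by (rule constant_derivative_imp_affine[of "\<lambda>y. fst (a (x, y))" "\<lambda>_. 0", simplified])
  obtain x y where p: "p = (x, y)" by (cases p)
  have "((\<lambda>y. snd (a (x, y))) has_derivative S (x, y)) (at y)"
    using has_derivative_snd[OF along_y[where x=x and y=y]] by simp
  moreover have "((\<lambda>y. snd (a (x, y))) has_derivative S (0, y)) (at y)"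
    using has_derivative_snd[OF along_y[where x=0 and y=y]] by (simp add: snd_a[of x])
  ultimately have 1: "S (x, y) = S (0, y)"
    by (rule has_derivative_unique)
  have "((\<lambda>x. fst (a (x, y))) has_derivative S (0, y)) (at 0)"
    using has_derivative_fst[OF along_x[where x=0 and y=y]] by simp
  moreover have "((\<lambda>x. fst (a (x, y))) has_derivative S (0, 0)) (at 0)"
    using has_derivative_fst[OF along_x[where x=0 and y=0]] by (simp add: fst_a[of _ y])
  ultimately have "S (0, y) = S (0, 0)"
    by (rule has_derivative_unique)
  with 1 p show ?thesis by (simp add: zero_prod_def)
qed

text \<open>The condition on \<open>A\<close> is exploited before the one on its shadow's tangent
  map: surjectivity of \<open>A\<close> on tangent spaces comes from the two bijections, whereas
  that of the tangent map is deduced from the resulting block form of \<open>A\<close>.\<close>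

lemma preserving_cases:
  assumes A: "A \<in> Lpa" and bij_A: "bij A" and bij_covered: "bij (covered A)"
    and metric: "preserves_pseudo_metric A"
    and conn_A: "preserves_connection A"
    and conn_Ta: "preserves_connection (tangent_map (covered A))"
  obtains R t c where "orthogonal_matrix R" "A = tangent_map (rigid_motion R t c)"
proof -
  from A obtain a where a: "a \<in> Aff" and bm: "bundle_morphism_over A a"
    and vert: "\<And>w. w \<in> vertical_bundle \<Longrightarrow> A w = tangent_map a w"
    unfolding Lpa_def by blast
  have Aa: "fst \<circ> A = a \<circ> fst" and lin: "\<And>p. linear (\<lambda>v. snd (A (p, v)))"
    using bm by (auto simp: bundle_morphism_over_def)
  have bij_a: "bij a" and conn_Ta: "preserves_connection (tangent_map a)"
    using covered_eq[OF Aa] bij_covered conn_Ta by auto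
  define abar where "abar = covered a"
  define D where "D p = frechet_derivative a (at p)" for p
  define D' where "D' x = frechet_derivative abar (at x)" for x
  note D = Aff_derivative(1)[OF a, folded D_def]
    and D' = Aff_derivative(2)[OF a, folded abar_def, folded D'_def]
    and cov = Aff_derivative(3)[OF a, folded abar_def]
    and fst_D = Aff_derivative(4)[OF a, folded abar_def, folded D_def D'_def]
  have Ta: "tangent_map a (p, v) = (a p, D p v)"
    and Tabar: "tangent_map abar (x, w) = (abar x, D' x w)" for p v x w
    by (simp_all add: tangent_map_def D_def D'_def)
  define B where "B p v = snd (A (p, v))" for p v
  have A_eq: "A (p, v) = (a p, B p v)" for p v
    using fun_cong[OF Aa, of "(p, v)"] by (simp add: B_def prod_eq_iff)
  have lin_B: "linear (B p)" for p
    using lin by (simp add: B_def[abs_def])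
  have lin_D: "linear (D p)" for p
    using D by (rule has_derivative_linear)
  have B_vert: "B p (0, w) = D p (0, w)" for p w
    using vert[of "(p, (0, w))"] by (simp add: vertical_bundle_def tangent_map_fst A_eq Ta)
  have D'0: "D' x 0 = 0" for x
    using D' by (intro linear_0 has_derivative_linear)
  \<comment> \<open>A preimage under \<open>A\<close> could lie over another point; injectivity of
    the shadow \<open>a\<close> excludes this.\<close>
  have surj_A: "tangent_space (a p) \<subseteq> A ` tangent_space p" for p
  proof
    fix w assume w: "w \<in> tangent_space (a p)"
    obtain q v where qv: "w = A (q, v)"
      using bij_is_surj[OF bij_A] by (metis surjD surj_pair)
    with w have "a q = a p"
      by (simp add: A_eq tangent_space_def)
    with bij_is_inj[OF bij_a] have "q = p"
      by (rule injD)
    with qv show "w \<in> A ` tangent_space p"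
      by (simp add: tangent_space_def)
  qed
  have B_hor: "B p (v, 0) = (D' (fst p) v, 0)" for p v
    using preserves_connection_horizontal[OF Aa cov surj_A conn_A, of p v] by (simp add: A_eq Tabar)
  have B_eq: "B p v = (D' (fst p) (fst v), snd (D p (0, snd v)))" for p v
  proof -
    have "B p v = B p (fst v, 0) + B p (0, snd v)"
      using linear_add[OF lin_B, of p "(fst v, 0)" "(0, snd v)"] by simp
    then show ?thesis
      by (simp add: B_hor B_vert prod_eq_iff fst_D D'0)
  qed
  \<comment> \<open>Relative to the splitting into horizontal and vertical vectors, \<open>D p\<close> is block triangular with
     the same diagonal blocks as the surjective map \<open>B p\<close>.\<close>
  have surj_Ta: "tangent_space (a p) \<subseteq> tangent_map a ` tangent_space p" for p
  proof
    fix w assume "w \<in> tangent_space (a p)"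
    then obtain w1 w2 where w: "w = (a p, (w1, w2))"
      by (auto simp: tangent_space_def)
    have surj_B: "\<exists>v. B p v = u" for u
    proof -
      have "(a p, u) \<in> A ` tangent_space p"
        using surj_A[of p] by (auto simp: tangent_space_def)
      then obtain w where "w \<in> tangent_space p" "A w = (a p, u)"
        by (metis imageE)
      then have "B p (snd w) = u"
        using A_eq[of p "snd w"] by (auto simp: tangent_space_def)
      then show ?thesis ..
    qed
    obtain v1 where v1: "D' (fst p) v1 = w1"
      using surj_B[of "(w1, 0)"] by (auto simp: B_eq)
    \<comment> \<open>Back substitution: the vertical part already contributed by
      \<open>(v1, 0)\<close> is subtracted from the target.\<close>
    obtain v2 where v2: "snd (D p (0, v2)) = w2 - snd (D p (v1, 0))"
      using surj_B[of "(0, w2 - snd (D p (v1, 0)))"] by (auto simp: B_eq)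
    have "D p (v1, v2) = D p (v1, 0) + D p (0, v2)"
      using linear_add[OF lin_D, of p "(v1, 0)" "(0, v2)"] by simp
    then have "D p (v1, v2) = (w1, w2)"
      by (simp add: prod_eq_iff fst_D D'0 v1 v2)
    then show "w \<in> tangent_map a ` tangent_space p"
      by (intro image_eqI[of _ _ "(p, (v1, v2))"]) (simp_all add: w Ta tangent_space_def)
  qed
  have Ta_covers: "fst \<circ> tangent_map a = a \<circ> fst"
    by (auto simp: tangent_map_def)
  have D_hor: "D p (v, 0) = (D' (fst p) v, 0)" for p v
    using preserves_connection_horizontal[OF Ta_covers cov surj_Ta conn_Ta, of p v]
    by (simp add: Ta Tabar)
  have D_eq_B: "D p v = B p v" for p v
  proof -
    have "D p v = D p (fst v, 0) + D p (0, snd v)"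
      using linear_add[OF lin_D, of p "(fst v, 0)" "(0, snd v)"] by simp
    then show ?thesis
      by (simp add: B_eq D_hor prod_eq_iff fst_D D'0)
  qed
  have A_Ta: "A = tangent_map a"
    by (auto simp: A_eq Ta D_eq_B)

  \<comment> \<open>Indexed by points of \<open>total\<close> to fit
    \<open>block_diagonal_derivative_constant\<close>.\<close>
  define S where "S p = D' (fst p)" for p :: total
  have inner_B: "(fst (B p v) + snd (B p v)) \<bullet> (fst (B p w) + snd (B p w)) =
      (fst v + snd v) \<bullet> (fst w + snd w)" for p v w
  proof -
    have "pseudo_metric (A (p, v)) (A (p, w)) = pseudo_metric (p, v) (p, w)"
      using metric
      unfolding preserves_pseudo_metric_def pullback_metric_def tangent_space_def by blast
    then show ?thesis
      by (simp only: A_eq pseudo_metric_apply)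
  qed
  have block: "snd (D p (0, v)) = S p v" for p v
  proof -
    \<comment> \<open>The vector \<open>(-v, v)\<close> is null for the pseudo-metric, so its image
      is null as well. This forces the horizontal and vertical blocks of \<open>B p\<close> to
      coincide.\<close>
    have "fst (B p (-v, v)) + snd (B p (-v, v)) = 0"
      using inner_B[of p "(-v, v)" "(-v, v)"] by simp
    moreover have "D' (fst p) (-v) = - D' (fst p) v"
      using D' by (intro linear_neg has_derivative_linear)
    ultimately show ?thesis
      by (simp add: B_eq S_def)
  qed
  have D_block: "D p = (\<lambda>v. (S p (fst v), S p (snd v)))" for p
  proof
    show "D p v = (S p (fst v), S p (snd v))" for v
      using D_eq_B[of p v] by (simp add: B_eq block) (simp add: S_def)
  qed
  have S_const: "S p = S 0" for p
    by (rule block_diagonal_derivative_constant[of a S]) (rule D[unfolded D_block])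
  have D_const: "D p = (\<lambda>v. (S 0 (fst v), S 0 (snd v)))" for p
    using D_block[of p] S_const[of p] by simp
  have "linear (S 0)"
    unfolding S_def using D' by (rule has_derivative_linear)
  \<comment> \<open>On horizontal vectors the pseudo-metric is the Euclidean inner product.\<close>
  moreover have "S 0 v \<bullet> S 0 w = v \<bullet> w" for v w
    using inner_B[of 0 "(v, 0)" "(w, 0)"] by (simp add: B_hor S_def)
  ultimately have "orthogonal_transformation (S 0)"
    by (simp add: orthogonal_transformation_def)
  then have R: "orthogonal_matrix (matrix (S 0))" and SR: "matrix (S 0) *v v = S 0 v" for v
    using orthogonal_transformation_matrix[of "S 0"] by (auto simp: matrix_works)
  have "a = rigid_motion (matrix (S 0)) (fst (a 0)) (snd (a 0))"
    by (rule derivative_imp_rigid_motion) (simp only: SR D[unfolded D_const])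
  then show ?thesis
    using that[OF R] A_Ta by metis
qed

theorem mainTheorem8:
  shows "generalised_TGal =
    {A \<in> Lpa. bij A \<and> bij (covered A) \<and> preserves_pseudo_metric A \<and>
       preserves_connection A \<and> preserves_connection (tangent_map (covered A))}"
proof (intro set_eqI iffI)
  fix A assume "A \<in> generalised_TGal"
  then obtain R t c where "orthogonal_matrix R" "A = tangent_map (rigid_motion R t c)"
    by (rule generalised_TGal_cases)
  then show "A \<in> {A \<in> Lpa. bij A \<and> bij (covered A) \<and> preserves_pseudo_metric A \<and>
      preserves_connection A \<and> preserves_connection (tangent_map (covered A))}"
    using rigid_motion_preserves[of R] tangent_map_rigid_motion_in_Lpa
    by (simp add: covered_tangent_map)
next
  fix A assume "A \<in> {A \<in> Lpa. bij A \<and> bij (covered A) \<and> preserves_pseudo_metric A \<and>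
      preserves_connection A \<and> preserves_connection (tangent_map (covered A))}"
  then obtain R t c where "orthogonal_matrix R" "A = tangent_map (rigid_motion R t c)"
    by (auto elim: preserving_cases)
  then show "A \<in> generalised_TGal"
    by (simp add: rigid_motion_in_generalised_TGal)
qed

end
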